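(* In the affine geometry $\mathrm{AG}(7,2)$, modeled as $\mathbb{Z}_2^7$: (1) there are exactly two affine equivalence classes of caps of size $10$; (2) there is exactly one affine equivalence class of caps of size $11$, and exactly one affine equivalence class of caps of size $12$.
   Context: A quad in $\mathbb{Z}_2^n$ is a set of four distinct vectors whose sum is $\mathbf{0}$. A cap is a subset of $\mathbb{Z}_2^n$ containing no quad. An affine transformation is a map $x\mapsto L(x)+b$ with $L$ linear; two subsets are affinely equivalent if there is an invertible affine transformation mapping one onto the other. *)

theory Defs
  imports "HOL-Analysis.Cartesian_Space" "HOL-Library.Z2" "HOL-Library.Numeral_Type"
begin

definition quad :: "(bit ^ 'n) set \<Rightarrow> bool" where
  "quad Q \<longleftrightarrow> card Q = 4 \<and> (\<Sum>x\<in>Q. x) = 0"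

definition cap :: "(bit ^ 'n) set \<Rightarrow> bool" where
  "cap C \<longleftrightarrow> (\<nexists>Q. Q \<subseteq> C \<and> quad Q)"

definition affine_transformation :: "(bit ^ 'n \<Rightarrow> bit ^ 'n) \<Rightarrow> bool" where
  "affine_transformation f \<longleftrightarrow>
     (\<exists>L b. Vector_Spaces.linear (*s) (*s) L \<and> f = (\<lambda>x. L x + b))"

definition affinely_equivalent :: "(bit ^ 'n) set \<Rightarrow> (bit ^ 'n) set \<Rightarrow> bool" where
  "affinely_equivalent A B \<longleftrightarrow> (\<exists>f. affine_transformation f \<and> bij f \<and> f ` A = B)"

definition caps_of_size :: "nat \<Rightarrow> (bit ^ 'n) set set" where
  "caps_of_size k = {C. cap C \<and> card C = k}"

definition affine_equiv_on :: "(bit ^ 'n) set set \<Rightarrow> ((bit ^ 'n) set \<times> (bit ^ 'n) set) set" where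
  "affine_equiv_on X = {(A, B). A \<in> X \<and> B \<in> X \<and> affinely_equivalent A B}"

lemma affinely_equivalent_refl: "affinely_equivalent A A"
proof -
  have "Vector_Spaces.linear (*s) (*s) (\<lambda>x :: bit ^ 'n. x)"
    by (rule vec.linear_ident)
  then have "affine_transformation (\<lambda>x :: bit ^ 'n. x)"
    unfolding affine_transformation_def
    by (intro exI[of _ "\<lambda>x. x"] exI[of _ 0]) auto
  then show ?thesis
    unfolding affinely_equivalent_def by (intro exI[of _ "\<lambda>x. x"]) (auto simp: bij_def)
qed

lemma affinely_equivalent_sym:
  assumes "affinely_equivalent A B"
  shows "affinely_equivalent B A"
proof -
  from assms obtain L b
    where L: "Vector_Spaces.linear (*s) (*s) L"
      and bij: "bij (\<lambda>x. L x + b)" and B: "(\<lambda>x. L x + b) ` A = B"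
    unfolding affinely_equivalent_def affine_transformation_def by blast
  have "L = (\<lambda>y. y - b) \<circ> (\<lambda>x. L x + b)"
    by (simp add: fun_eq_iff)
  moreover have "bij (\<lambda>y :: bit ^ 'a. y - b)"
    by (rule bij_betw_byWitness[where f' = "\<lambda>y. y + b"]) auto
  ultimately have bL: "bij L"
    using bij bij_comp by metis
  obtain M where M: "Vector_Spaces.linear (*s) (*s) M" "M \<circ> L = id"
    using vec.linear_injective_left_inverse[OF L bij_is_inj[OF bL]] by blast
  have M_L: "M (L x) = x" for x
    using M(2) by (simp add: fun_eq_iff)
  have L_M: "L (M y) = y" for y
    using M_L bij_is_surj[OF bL] by (metis surjD)
  define g where "g = (\<lambda>y. M y + M (- b))"
  have g: "g y = M (y - b)" for y
    unfolding g_def using vec.linear_add[OF M(1), of y "- b"] by simp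
  have 1: "affine_transformation g"
    unfolding affine_transformation_def g_def using M(1) by blast
  have 2: "bij g"
    by (rule bij_betw_byWitness[where f' = "\<lambda>x. L x + b"]) (auto simp: g M_L L_M)
  have 3: "g ` B = A"
    unfolding B[symmetric] image_image by (simp add: g M_L)
  show ?thesis
    unfolding affinely_equivalent_def using 1 2 3 by blast
qed

lemma affinely_equivalent_trans:
  assumes "affinely_equivalent A B" "affinely_equivalent B C"
  shows "affinely_equivalent A C"
proof -
  from assms(1) obtain L b
    where L: "Vector_Spaces.linear (*s) (*s) L"
      and b: "bij (\<lambda>x. L x + b)" and B: "(\<lambda>x. L x + b) ` A = B"
    unfolding affinely_equivalent_def affine_transformation_def by blast
  from assms(2) obtain M c
    where M: "Vector_Spaces.linear (*s) (*s) M"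
      and c: "bij (\<lambda>x. M x + c)" and C: "(\<lambda>x. M x + c) ` B = C"
    unfolding affinely_equivalent_def affine_transformation_def by blast
  define h where "h = (\<lambda>x. M x + c) \<circ> (\<lambda>x. L x + b)"
  have "h = (\<lambda>x. (M \<circ> L) x + (M b + c))"
    unfolding h_def by (simp add: fun_eq_iff vec.linear_add[OF M] add.assoc)
  moreover have "Vector_Spaces.linear (*s) (*s) (M \<circ> L)"
    using L M by (rule Vector_Spaces.linear_compose)
  ultimately have "affine_transformation h"
    unfolding affine_transformation_def by blast
  moreover have "bij h"
    unfolding h_def using b c by (rule bij_comp)
  moreover have "h ` A = C"
    unfolding h_def image_comp[symmetric] B C ..
  ultimately show ?thesis
    unfolding affinely_equivalent_def by blast
qed

lemma equiv_affine_equiv_on: "equiv X (affine_equiv_on X)"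
  unfolding affine_equiv_on_def equiv_def refl_on_def sym_def trans_def
  by (auto intro: affinely_equivalent_refl affinely_equivalent_sym affinely_equivalent_trans)

definition affine_classes :: "(bit ^ 'n) set set \<Rightarrow> (bit ^ 'n) set set set" where
  "affine_classes X = X // affine_equiv_on X"

end

theory Submission
  imports Defs
begin

text \<open>
  In a cap, every nonempty subset of even size with sum zero has at least six elements. Three
  independent such subsets generate seven, whose sizes add up to four times the size of their
  union (Plotkin). Hence a cap with at least 10 points contains an affine frame of eight points,
  and a cap with at least 11 points contains a zero-sum subset of size 8. Relative to a frame
  \<open>B\<close> every further point is the sum of the complement in \<open>B\<close> of a set of size 1 or 3, and these
  sets are nearly disjoint. A frame that contains seven points of a zero-sum 8-set makes one of
  them a singleton, which forces the configuration of the others up to relabelling the frame.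
  A 10-cap without a zero-sum 8-set has two triples meeting in one point. The existence of a
  zero-sum 8-set is an affine invariant, so it separates the two classes of 10-caps.
\<close>

section \<open>Binary vectors, symmetric differences and zero-sum subsets of caps\<close>

lemma CARD_bit [simp]: "CARD(bit) = 2"
proof -
  have "(UNIV :: bit set) = {0, 1}"
    using bit.nchotomy by auto
  then show ?thesis
    by (metis card_2_iff zero_neq_one)
qed

lemma finite_bit_vec_set [simp]: "finite (A :: (bit ^ 'n) set)"
proof -
  have "0 < CARD(bit ^ 'n)"
    by simp
  then show ?thesis
    by (metis card_gt_0_iff finite_subset subset_UNIV)
qed

lemma bit_vec_add_self [simp]: "x + x = (0 :: bit ^ 'n)"
  by (simp add: vec_eq_iff)

lemma bit_vec_add_self_left [simp]: "x + (x + y) = (y :: bit ^ 'n)"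
  by (simp add: add.assoc[symmetric])

lemma bit_vec_add_eq_iff: "x + y = z \<longleftrightarrow> x = y + (z :: bit ^ 'n)"
  by (metis add.commute bit_vec_add_self_left)

lemma sum_bit_vec_const: "(\<Sum>i\<in>X. c) = (if even (card X) then 0 else c :: bit ^ 'n)" if "finite X"
  using that by (induction X rule: finite_induct) (auto simp del: sum_constant)

text \<open>Terms indexed by the intersection occur twice on the right and cancel in characteristic
  two. So zero-sum sets are closed under symmetric difference.\<close>

lemma sum_sym_diff:
  fixes g :: "'a \<Rightarrow> bit ^ 'n"
  assumes "finite X" "finite Y"
  shows "sum g (sym_diff X Y) = sum g X + sum g Y"
proof -
  have "sum g (sym_diff X Y) = sum g (X - Y) + sum g (Y - X)"
    using assms by (intro sum.union_disjoint) auto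
  moreover have "sum g X = sum g (X \<inter> Y) + sum g (X - Y)"
    using assms sum.Int_Diff by blast
  moreover have "sum g Y = sum g (X \<inter> Y) + sum g (Y - X)"
    using assms by (metis inf_commute sum.Int_Diff)
  ultimately show ?thesis
    by (simp add: ac_simps)
qed

lemma card_sym_diff:
  assumes "finite X" "finite Y"
  shows "card (sym_diff X Y) + 2 * card (X \<inter> Y) = card X + card Y"
proof -
  have "card (sym_diff X Y) = card (X - Y) + card (Y - X)"
    using assms by (intro card_Un_disjoint) auto
  moreover have "card X = card (X \<inter> Y) + card (X - Y)"
    using assms by (metis card_Int_Diff)
  moreover have "card Y = card (X \<inter> Y) + card (Y - X)"
    using assms by (metis card_Int_Diff inf_commute)
  ultimately show ?thesis
    by simp
qed

lemma even_card_sym_diff: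
  assumes "finite X" "finite Y"
  shows "even (card (sym_diff X Y)) \<longleftrightarrow> (even (card X) \<longleftrightarrow> even (card Y))"
proof -
  have "even (card (sym_diff X Y) + 2 * card (X \<inter> Y)) \<longleftrightarrow> even (card X + card Y)"
    using card_sym_diff[OF assms] by simp
  then show ?thesis
    by simp
qed

text \<open>Every point of the union lies in exactly four of the seven sets, as in the Plotkin bound.\<close>

lemma card_sym_diffs_plotkin:
  assumes "finite X" "finite Y" "finite Z"
  shows "card X + card Y + card Z + card (sym_diff X Y) + card (sym_diff X Z) +
    card (sym_diff Y Z) + card (sym_diff (sym_diff X Y) Z) = 4 * card (X \<union> Y \<union> Z)"
proof -
  let ?U = "X \<union> Y \<union> Z"
  have card_eq: "card S = (\<Sum>x\<in>?U. of_bool (x \<in> S))" if "S \<subseteq> ?U" for S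
    using that assms by (simp add: of_bool_def sum.If_cases Int_absorb1)
  let ?w = "\<lambda>x. of_bool (x \<in> X) + of_bool (x \<in> Y) + of_bool (x \<in> Z) + of_bool (x \<in> sym_diff X Y) +
    of_bool (x \<in> sym_diff X Z) + of_bool (x \<in> sym_diff Y Z) + of_bool (x \<in> sym_diff (sym_diff X Y) Z) :: nat"
  have "card X + card Y + card Z + card (sym_diff X Y) + card (sym_diff X Z) +
    card (sym_diff Y Z) + card (sym_diff (sym_diff X Y) Z) = (\<Sum>x\<in>?U. ?w x)"
    unfolding sum.distrib
    by (intro arg_cong2[where f = "(+)"]; intro card_eq; blast)
  also have "\<dots> = (\<Sum>x\<in>?U. 4)"
    by (intro sum.cong) auto
  finally show ?thesis
    by simp
qed

text \<open>Size 2 would make two distinct vectors equal, and size 4 would be a quad.\<close>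

lemma cap_zero_sum_card_ge_6:
  assumes "cap C" "D \<subseteq> C" "even (card D)" "\<Sum>D = 0" "D \<noteq> {}"
  shows "6 \<le> card D"
proof (rule ccontr)
  assume "\<not> 6 \<le> card D"
  moreover have "card D \<noteq> 0"
    using assms(5) by simp
  ultimately have "card D = 2 \<or> card D = 4"
    using assms(3) by presburger
  then show False
  proof
    assume "card D = 2"
    then obtain x y where "D = {x, y}" "x \<noteq> y"
      by (auto simp: card_2_iff)
    with assms(4) show False
      by (simp add: bit_vec_add_eq_iff)
  next
    assume "card D = 4"
    with assms show False
      by (auto simp: cap_def quad_def)
  qed
qed

section \<open>Affine independence and affine frames\<close>

text \<open>The coefficients of an affine dependence are 0 or 1 and add up to 0, so a dependence is
  just a zero-sum subset of even size. The points are indexed so that two frames can be matched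
  index by index.\<close>

definition affinely_independent :: "'a set \<Rightarrow> ('a \<Rightarrow> bit ^ 'n) \<Rightarrow> bool" where
  "affinely_independent I a \<longleftrightarrow> (\<forall>D\<subseteq>I. even (card D) \<and> sum a D = 0 \<longrightarrow> D = {})"

lemma affinely_independent_empty: "affinely_independent {} a"
  by (simp add: affinely_independent_def)

text \<open>With \<open>a k\<close> as origin, the differences \<open>a i + a k\<close> are linearly
  independent: if two sums agree, the symmetric difference \<open>D\<close> of their index sets
  carries a dependence, after inserting \<open>k\<close> when its size is odd.\<close>

lemma inj_on_sum_affinely_independent:
  assumes "affinely_independent I a" "finite I" "k \<in> I"
  shows "inj_on (\<lambda>X. \<Sum>i\<in>X. a i + a k) (Pow (I - {k}))"
proof (intro inj_onI)
  fix X Y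
  assume X: "X \<in> Pow (I - {k})" and Y: "Y \<in> Pow (I - {k})"
    and eq: "(\<Sum>i\<in>X. a i + a k) = (\<Sum>i\<in>Y. a i + a k)"
  have fin: "finite X" "finite Y"
    using X Y assms(2) finite_subset by fastforce+
  define D where "D = sym_diff X Y"
  have D: "finite D" "D \<subseteq> I" "k \<notin> D"
    using X Y fin by (auto simp: D_def)
  have "(\<Sum>i\<in>D. a i + a k) = 0"
    unfolding D_def sum_sym_diff[OF fin] eq by simp
  then have sumD: "sum a D + (if even (card D) then 0 else a k) = 0"
    using D(1) by (simp add: sum.distrib sum_bit_vec_const del: sum_constant)
  have "D = {}"
  proof (cases "even (card D)")
    case True
    with sumD D assms(1) show ?thesis
      by (auto simp: affinely_independent_def)
  next
    case False
    then have "even (card (insert k D))" "sum a (insert k D) = 0"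
      using sumD D by (simp_all add: add.commute)
    with D(2) assms(1,3) show ?thesis
      unfolding affinely_independent_def by (metis insert_not_empty insert_subset)
  qed
  then show "X = Y"
    by (auto simp: D_def)
qed

lemma affinely_independent_card_le:
  fixes a :: "'a \<Rightarrow> bit ^ 'n"
  assumes "affinely_independent I a" "finite I"
  shows "card I \<le> CARD('n) + 1"
proof (cases "I = {}")
  case False
  then obtain k where k: "k \<in> I"
    by blast
  have "card (Pow (I - {k})) \<le> CARD(bit ^ 'n)"
    by (rule card_inj_on_le[OF inj_on_sum_affinely_independent[OF assms k]]) auto
  then have "2 ^ card (I - {k}) \<le> (2 :: nat) ^ CARD('n)"
    using assms(2) by (simp add: card_Pow)
  then show ?thesis
    using k assms(2) by simp
qed simp

text \<open>Sums over odd index sets are affine combinations, so the affine map sending each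
  \<open>a i\<close> to \<open>b i\<close> sends \<open>sum a X\<close> to \<open>sum b X\<close>.
  Its linear part is defined through coordinates relative to the origin \<open>a k\<close>.\<close>

lemma affine_frames_equivalent:
  fixes a b :: "'a \<Rightarrow> bit ^ 'n"
  assumes a: "affinely_independent I a" and b: "affinely_independent I b"
    and I: "finite I" "card I = CARD('n) + 1"
    and F: "\<And>X. X \<in> F \<Longrightarrow> X \<subseteq> I \<and> odd (card X)"
  shows "affinely_equivalent (sum a ` F) (sum b ` F)"
proof -
  obtain k where k: "k \<in> I"
    using I by fastforce
  let ?P = "Pow (I - {k})"
  let ?s = "\<lambda>a X. \<Sum>i\<in>X. a i + a k :: bit ^ 'n"
  have bij: "bij_betw (?s a) ?P UNIV" if "affinely_independent I a" for a :: "'a \<Rightarrow> bit ^ 'n"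
  proof (rule bij_betw_imageI[OF inj_on_sum_affinely_independent[OF that I(1) k]])
    have "card (?s a ` ?P) = CARD(bit ^ 'n)"
      unfolding card_image[OF inj_on_sum_affinely_independent[OF that I(1) k]]
      using I k by (simp add: card_Pow)
    then show "?s a ` ?P = UNIV"
      by (intro card_subset_eq) auto
  qed
  \<comment> \<open>\<open>c x\<close> is the coordinate set of \<open>x\<close>; addition of
    vectors becomes symmetric difference of these sets.\<close>
  define c where "c = the_inv_into ?P (?s a)"
  have c: "bij_betw c UNIV ?P"
    unfolding c_def using bij_betw_the_inv_into[OF bij[OF a]] .
  have c_s: "c (?s a X) = X" if "X \<in> ?P" for X
    unfolding c_def using bij[OF a] that by (simp add: the_inv_into_f_f bij_betw_def)
  have s_c: "?s a (c x) = x" for x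
    unfolding c_def using bij[OF a] by (simp add: f_the_inv_into_f_bij_betw)
  define L where "L = (\<lambda>x. ?s b (c x))"
  have c_P: "c x \<in> ?P" for x
    using bij_betwE[OF c] by blast
  have fin_c: "finite (c x)" for x
    using c_P[of x] I(1) finite_subset by fastforce
  have c_add: "c (x + y) = sym_diff (c x) (c y)" for x y
  proof -
    have "x + y = ?s a (sym_diff (c x) (c y))"
      unfolding sum_sym_diff[OF fin_c fin_c] s_c ..
    moreover have "sym_diff (c x) (c y) \<in> ?P"
      using c_P[of x] c_P[of y] by blast
    ultimately show ?thesis
      using c_s by metis
  qed
  have L_add: "L (x + y) = L x + L y" for x y
    unfolding L_def c_add sum_sym_diff[OF fin_c fin_c] ..
  have L_0: "L 0 = 0"
    using L_add[of 0 0] by simp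
  \<comment> \<open>The only scalars are 0 and 1, so additivity already gives linearity.\<close>
  have L_scale: "L (r *s x) = r *s L x" for r x
    by (cases r) (auto simp: L_0)
  have linear_L: "Vector_Spaces.linear (*s) (*s) L"
    unfolding Vector_Spaces.linear_iff
    using L_add L_scale by (auto simp: vec.vector_space_axioms)
  \<comment> \<open>The translation is chosen so that \<open>a k\<close> goes to
    \<open>b k\<close>.\<close>
  define f where "f = (\<lambda>x. L x + (L (a k) + b k))"
  have bij_L: "bij L"
    unfolding L_def using bij_betw_trans[OF c bij[OF b]] by (simp add: comp_def)
  have "bij (\<lambda>y. y + (L (a k) + b k))"
    by (rule bij_betw_byWitness[where f' = "\<lambda>y. y + (L (a k) + b k)"]) (auto simp: ac_simps)
  then have bij_f: "bij f"
    using bij_comp[OF bij_L] by (simp add: f_def comp_def)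
  have f_a: "L (a i) = b i + (L (a k) + b k)" if "i \<in> I" for i
  proof (cases "i = k")
    case False
    with that have "c (?s a {i}) = {i}"
      by (intro c_s) auto
    then have "L (a i + a k) = b i + b k"
      by (simp add: L_def)
    then show ?thesis
      unfolding L_add by (simp add: bit_vec_add_eq_iff ac_simps)
  qed (simp add: ac_simps)
  have "f (sum a X) = sum b X" if "X \<in> F" for X
  proof -
    have X: "X \<subseteq> I" "odd (card X)" "finite X"
      using F[OF that] I(1) finite_subset by auto
    have "L (sum a X) = (\<Sum>i\<in>X. b i + (L (a k) + b k))"
      unfolding vec.linear_sum[OF linear_L] using X(1) f_a by (intro sum.cong) auto
    \<comment> \<open>The size of \<open>X\<close> is odd, so exactly one copy of the constant
      survives.\<close>
    also have "\<dots> = sum b X + (L (a k) + b k)"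
      using X by (simp add: sum.distrib sum_bit_vec_const del: sum_constant)
    finally show ?thesis
      by (simp add: f_def add.assoc)
  qed
  then have "f ` sum a ` F = sum b ` F"
    by (force simp: image_image intro: image_cong)
  moreover have "affine_transformation f"
    unfolding affine_transformation_def f_def using linear_L by blast
  ultimately show ?thesis
    unfolding affinely_equivalent_def using bij_f by blast
qed

section \<open>Frames inside large caps\<close>

text \<open>Each of the three points gives a zero-sum set. Each of the seven combinations of these
  sets contains \<open>u\<close>, \<open>v\<close> or \<open>w\<close>, so it is nonempty and has at
  least six points. The Plotkin identity then reads
  \<open>42 <= 4 * card (P \<union> Q \<union> R)\<close>, and the union has at most
  \<open>card B + 3\<close> points.\<close>

lemma cap_three_circuits:
  assumes "cap C" "B \<subseteq> C" "u \<in> C - B" "v \<in> C - B" "w \<in> C - B" "u \<noteq> v" "u \<noteq> w" "v \<noteq> w"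
    and "X \<subseteq> B" "odd (card X)" "u = \<Sum>X"
    and "Y \<subseteq> B" "odd (card Y)" "v = \<Sum>Y"
    and "Z \<subseteq> B" "odd (card Z)" "w = \<Sum>Z"
  shows "8 \<le> card B"
    and "card B = 8 \<Longrightarrow> \<exists>S\<subseteq>C. card S = 8 \<and> \<Sum>S = 0"
proof -
  define P where "P = insert u X"
  define Q where "Q = insert v Y"
  define R where "R = insert w Z"
  define zs where "zs D \<longleftrightarrow> D \<subseteq> C \<and> even (card D) \<and> \<Sum>D = 0" for D
  have zs_sym: "zs (sym_diff D E)" if "zs D" "zs E" for D E
  proof -
    have "sym_diff D E \<subseteq> C"
      using that by (auto simp: zs_def)
    moreover have "even (card (sym_diff D E))"
      using that even_card_sym_diff[of D E] by (simp add: zs_def)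
    moreover have "\<Sum>(sym_diff D E) = 0"
      using that sum_sym_diff[of D E "\<lambda>x. x"] by (simp add: zs_def)
    ultimately show ?thesis
      unfolding zs_def by blast
  qed
  have zs_insert: "zs (insert x D)" if "x \<in> C - B" "D \<subseteq> B" "odd (card D)" "x = \<Sum>D" for x D
  proof -
    have "x \<notin> D"
      using that by blast
    then show ?thesis
      using that assms(2) by (auto simp: zs_def)
  qed
  have zs: "zs P" "zs Q" "zs R"
    unfolding P_def Q_def R_def
    using zs_insert[OF assms(3,9-11)] zs_insert[OF assms(4,12-14)] zs_insert[OF assms(5,15-17)] by simp_all
  have large: "6 \<le> card D \<and> even (card D)" if "zs D" "x \<in> D" for D x
    using cap_zero_sum_card_ge_6[OF assms(1)] that by (auto simp: zs_def)
  have mem: "u \<in> P" "u \<notin> Q" "u \<notin> R" "v \<in> Q" "v \<notin> R" "w \<in> R"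
    using assms(3-9,12,15) by (auto simp: P_def Q_def R_def)
  have cards: "6 \<le> card P \<and> even (card P)" "6 \<le> card Q \<and> even (card Q)" "6 \<le> card R \<and> even (card R)"
    "6 \<le> card (sym_diff P Q) \<and> even (card (sym_diff P Q))"
    "6 \<le> card (sym_diff P R) \<and> even (card (sym_diff P R))"
    "6 \<le> card (sym_diff Q R) \<and> even (card (sym_diff Q R))"
    "6 \<le> card (sym_diff (sym_diff P Q) R) \<and> even (card (sym_diff (sym_diff P Q) R))"
    using large[OF zs(1) mem(1)] large[OF zs(2) mem(4)] large[OF zs(3) mem(6)]
      large[OF zs_sym[OF zs(1,2)], of u] large[OF zs_sym[OF zs(1,3)], of u] large[OF zs_sym[OF zs(2,3)], of v]
      large[OF zs_sym[OF zs_sym[OF zs(1,2)] zs(3)], of u] mem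
    by blast+
  have "card (P \<union> Q \<union> R) \<le> card (insert u (insert v (insert w B)))"
    unfolding P_def Q_def R_def using assms(9,12,15) by (intro card_mono) auto
  also have "\<dots> = card B + 3"
    using assms(3-8) by simp
  finally have U: "card (P \<union> Q \<union> R) \<le> card B + 3" .
  note plotkin = card_sym_diffs_plotkin[of P Q R, OF finite_bit_vec_set finite_bit_vec_set finite_bit_vec_set]
  show "8 \<le> card B"
    using U plotkin cards[THEN conjunct1] by linarith
  show "\<exists>S\<subseteq>C. card S = 8 \<and> \<Sum>S = 0" if "card B = 8"
  proof -
    have "\<exists>D\<in>{P, Q, R, sym_diff P Q, sym_diff P R, sym_diff Q R, sym_diff (sym_diff P Q) R}. card D = 8"
    proof (rule ccontr)
      assume none: "\<not> ?thesis"
      \<comment> \<open>The seven sizes add up to at most 4 * 11 = 44, and any six of them to at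
        least 36.\<close>
      have le: "card P \<le> 8" "card Q \<le> 8" "card R \<le> 8" "card (sym_diff P Q) \<le> 8" "card (sym_diff P R) \<le> 8"
        "card (sym_diff Q R) \<le> 8" "card (sym_diff (sym_diff P Q) R) \<le> 8"
        using U plotkin cards[THEN conjunct1] \<open>card B = 8\<close> by linarith+
      have ne: "card P \<noteq> 8" "card Q \<noteq> 8" "card R \<noteq> 8" "card (sym_diff P Q) \<noteq> 8" "card (sym_diff P R) \<noteq> 8"
        "card (sym_diff Q R) \<noteq> 8" "card (sym_diff (sym_diff P Q) R) \<noteq> 8"
        using none by simp_all
      have eq_6: "k = 6" if "k \<noteq> 8" "k \<le> 8" "6 \<le> k \<and> even k" for k :: nat
        using that by presburger
      note ne(1)[THEN eq_6, OF le(1) cards(1)] ne(2)[THEN eq_6, OF le(2) cards(2)]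
        ne(3)[THEN eq_6, OF le(3) cards(3)] ne(4)[THEN eq_6, OF le(4) cards(4)]
        ne(5)[THEN eq_6, OF le(5) cards(5)] ne(6)[THEN eq_6, OF le(6) cards(6)]
        ne(7)[THEN eq_6, OF le(7) cards(7)]
      \<comment> \<open>Even sizes between 6 and 8, none equal to 8, are all 6; but 42 is not a
        multiple of 4.\<close>
      then have "42 = 4 * card (P \<union> Q \<union> R)"
        using plotkin by linarith
      then show False
        by presburger
    qed
    then obtain D where D: "D \<in> {P, Q, R, sym_diff P Q, sym_diff P R, sym_diff Q R, sym_diff (sym_diff P Q) R}"
      "card D = 8"
      by (elim bexE)
    have "zs D"
      using D(1) zs zs_sym[OF zs(1,2)] zs_sym[OF zs(1,3)] zs_sym[OF zs(2,3)] zs_sym[OF zs_sym[OF zs(1,2)] zs(3)]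
      by (elim insertE emptyE) simp_all
    with D(2) show ?thesis
      by (auto simp: zs_def)
  qed
qed

lemma cap_subset: "cap C \<Longrightarrow> D \<subseteq> C \<Longrightarrow> cap D"
  by (auto simp: cap_def)

text \<open>\<open>B\<close> is a maximal independent subset of \<open>C\<close> above
  \<open>I\<close>; by maximality, every other point of \<open>C\<close> is an odd sum over
  \<open>B\<close>. The dimension bounds \<open>B\<close> by 8 points. With at most 7 there would be
  three points outside, contradicting \<open>cap_three_circuits\<close>. The choice of
  \<open>I\<close> lets the frame contain prescribed points.\<close>

lemma cap_frame_exists:
  fixes C :: "(bit ^ 7) set"
  assumes C: "cap C" "10 \<le> card C"
    and I: "I \<subseteq> C" "affinely_independent I (\<lambda>x. x)"
  obtains B where "I \<subseteq> B" "B \<subseteq> C" "affinely_independent B (\<lambda>x. x)" "card B = 8"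
    and "\<And>c. c \<in> C - B \<Longrightarrow> \<exists>X\<subseteq>B. odd (card X) \<and> c = \<Sum>X"
proof -
  let ?A = "{B. B \<subseteq> C \<and> affinely_independent B (\<lambda>x. x)}"
  have "finite ?A"
    by (rule finite_subset[of _ "Pow C"]) auto
  then obtain B where B: "B \<in> ?A" "I \<subseteq> B" and max: "\<And>B'. B' \<in> ?A \<Longrightarrow> B \<subseteq> B' \<Longrightarrow> B = B'"
    using finite_has_maximal2[of ?A I] I by auto
  have span: "\<exists>X\<subseteq>B. odd (card X) \<and> c = \<Sum>X" if c: "c \<in> C - B" for c
  proof -
    have "insert c B \<notin> ?A"
      using max[of "insert c B"] c by blast
    then obtain D where D: "D \<subseteq> insert c B" "even (card D)" "\<Sum>D = 0" "D \<noteq> {}"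
      using B c by (auto simp: affinely_independent_def)
    have "c \<in> D"
      using D B(1) by (auto simp: affinely_independent_def subset_insert)
    then have c: "c + \<Sum>(D - {c}) = 0" "Suc (card (D - {c})) = card D"
      using D(3) sum.remove[of D c "\<lambda>x. x"] card_Suc_Diff1[of D c] by auto
    have "c = \<Sum>(D - {c})"
      using c(1) by (metis add_0_right bit_vec_add_eq_iff)
    moreover have "odd (card (D - {c}))"
      using c(2) D(2) by (metis even_Suc)
    ultimately show ?thesis
      using D(1) by blast
  qed
  have "card B \<le> 8"
    using affinely_independent_card_le[of B "\<lambda>x. x"] B by simp
  moreover have "8 \<le> card B"
  proof (rule ccontr)
    assume "\<not> 8 \<le> card B"
    then have "3 \<le> card (C - B)"
      using C(2) B(1) by (simp add: card_Diff_subset)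
    then obtain T where "T \<subseteq> C - B" "card T = 3"
      by (metis obtain_subset_with_card_n)
    then obtain u v w where T: "u \<in> C - B" "v \<in> C - B" "w \<in> C - B" "u \<noteq> v" "u \<noteq> w" "v \<noteq> w"
      by (auto simp: card_3_iff)
    obtain X Y Z where
      X: "X \<subseteq> B" "odd (card X)" "u = \<Sum>X" and
      Y: "Y \<subseteq> B" "odd (card Y)" "v = \<Sum>Y" and
      Z: "Z \<subseteq> B" "odd (card Z)" "w = \<Sum>Z"
      using T(1-3)[THEN span] by blast
    have "B \<subseteq> C"
      using B(1) by simp
    from cap_three_circuits(1)[OF C(1) this T X Y Z] \<open>\<not> 8 \<le> card B\<close> show False
      by blast
  qed
  ultimately show ?thesis
    using that[of B] B span by auto
qed

section \<open>Points of a cap relative to a frame of eight points\<close>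

locale framed_cap =
  fixes C B :: "(bit ^ 'n) set"
  assumes cap: "cap C" and B_subset: "B \<subseteq> C" and card_B: "card B = 8"
begin

text \<open>The point \<open>u\<close> is the sum over \<open>B - Y\<close>. The complement
  \<open>Y\<close> is recorded because it is the small set: it turns out to have 1 or 3 elements. As
  \<open>card B = 8\<close>, \<open>Y\<close> and \<open>B - Y\<close> have the same parity.\<close>

definition cosupport :: "bit ^ 'n \<Rightarrow> (bit ^ 'n) set \<Rightarrow> bool" where
  "cosupport u Y \<longleftrightarrow> u \<in> C - B \<and> Y \<subseteq> B \<and> odd (card Y) \<and> u = \<Sum>B + \<Sum>Y"

lemma sum_compl: "Y \<subseteq> B \<Longrightarrow> \<Sum>(B - Y) = \<Sum>B + \<Sum>Y"
  using sum_sym_diff[of B Y "\<lambda>x. x"] by (simp add: Diff_eq_empty_iff[THEN iffD2])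

lemma card_compl: "Y \<subseteq> B \<Longrightarrow> card (B - Y) = 8 - card Y" "Y \<subseteq> B \<Longrightarrow> card Y \<le> 8"
  using card_B card_mono[of B Y] by (auto simp: card_Diff_subset)

lemma cosupport_compl:
  assumes "u \<in> C - B" "X \<subseteq> B" "odd (card X)" "u = \<Sum>X"
  shows "cosupport u (B - X)"
  using assms card_compl[of X] by (auto simp: cosupport_def sum_compl)

lemma zero_sum_one:
  assumes "cosupport u Y"
  shows "insert u (B - Y) \<subseteq> C" "card (insert u (B - Y)) = 9 - card Y" "\<Sum>(insert u (B - Y)) = 0"
  using assms B_subset card_compl[of Y]
  by (auto simp: cosupport_def sum_compl)

text \<open>The zero-sum set \<open>insert u (B - Y)\<close> has size \<open>9 - card Y\<close>,
  which must be at least 6. A singleton cosupport corresponds to a zero-sum set of size 8, a triple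
  to one of size 6.\<close>

lemma cosupport_card:
  assumes "cosupport u Y"
  shows "card Y = 1 \<or> card Y = 3"
proof -
  have "even (9 - card Y)" "card Y \<le> 8" "odd (card Y)"
    using assms card_compl by (auto simp: cosupport_def)
  moreover from this have "6 \<le> 9 - card Y"
    using cap_zero_sum_card_ge_6[OF cap zero_sum_one(1)[OF assms]] zero_sum_one[OF assms] by auto
  ultimately show ?thesis
    by presburger
qed

text \<open>In \<open>u + v\<close> the two copies of the sum over \<open>B\<close> cancel, leaving
  the sum over \<open>sym_diff Y Z\<close>.\<close>

lemma zero_sum_two:
  assumes "cosupport u Y" "cosupport v Z" "u \<noteq> v"
  shows "insert u (insert v (sym_diff Y Z)) \<subseteq> C"
    "card (insert u (insert v (sym_diff Y Z))) = card (sym_diff Y Z) + 2"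
    "\<Sum>(insert u (insert v (sym_diff Y Z))) = 0"
proof -
  have "u \<notin> insert v (sym_diff Y Z)" "v \<notin> sym_diff Y Z"
    using assms by (auto simp: cosupport_def)
  then have "card (insert u (insert v (sym_diff Y Z))) = card (sym_diff Y Z) + 2"
    "\<Sum>(insert u (insert v (sym_diff Y Z))) = u + (v + (\<Sum>Y + \<Sum>Z))"
    using sum_sym_diff[of Y Z "\<lambda>x. x"] by simp_all
  then show "card (insert u (insert v (sym_diff Y Z))) = card (sym_diff Y Z) + 2"
    "\<Sum>(insert u (insert v (sym_diff Y Z))) = 0"
    using assms by (simp_all add: cosupport_def ac_simps)
  show "insert u (insert v (sym_diff Y Z)) \<subseteq> C"
    using assms B_subset by (auto simp: cosupport_def)
qed

lemma cosupport_pair: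
  assumes "cosupport u Y" "cosupport v Z" "u \<noteq> v"
  shows "4 \<le> card (sym_diff Y Z)"
proof -
  have "even (card (sym_diff Y Z))"
    using assms even_card_sym_diff[of Y Z] by (simp add: cosupport_def)
  then show ?thesis
    using cap_zero_sum_card_ge_6[OF cap zero_sum_two(1)[OF assms]] zero_sum_two(2,3)[OF assms] by simp
qed

text \<open>In \<open>u + v + w\<close> one copy of the sum over \<open>B\<close> survives, so the
  three points together with the complement of the triple symmetric difference \<open>?T\<close>
  form a zero-sum set. Its size \<open>11 - card ?T\<close> is at least 6.\<close>

lemma cosupport_triple:
  assumes "cosupport u Y" "cosupport v Z" "cosupport w W" "u \<noteq> v" "u \<noteq> w" "v \<noteq> w"
  shows "card (sym_diff (sym_diff Y Z) W) \<le> 5"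
proof -
  let ?T = "sym_diff (sym_diff Y Z) W"
  let ?D = "insert u (insert v (insert w (B - ?T)))"
  have "odd (card ?T)"
    using assms(1-3) even_card_sym_diff[of Y Z] even_card_sym_diff[of "sym_diff Y Z" W]
    by (simp add: cosupport_def)
  have T: "?T \<subseteq> B"
    using assms by (auto simp: cosupport_def)
  have notin: "u \<notin> insert v (insert w (B - ?T))" "v \<notin> insert w (B - ?T)" "w \<notin> B - ?T"
    using assms by (auto simp: cosupport_def)
  have "\<Sum>?D = u + (v + (w + (\<Sum>B + \<Sum>?T)))"
    using notin by (simp add: sum_compl[OF T])
  also have "\<Sum>?T = \<Sum>Y + \<Sum>Z + \<Sum>W"
    by (simp add: sum_sym_diff)
  finally have sum: "\<Sum>?D = 0"
    using assms by (simp add: cosupport_def ac_simps)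
  have "card ?D = 3 + card (B - ?T)"
    using notin by simp
  then have card: "card ?D = 11 - card ?T"
    using card_compl[OF T] by simp
  have "even (card ?D)"
    using \<open>odd (card ?T)\<close> card card_compl(2)[OF T] by simp
  moreover have "?D \<subseteq> C"
    using assms B_subset by (auto simp: cosupport_def)
  ultimately have "6 \<le> card ?D"
    using cap_zero_sum_card_ge_6[OF cap] sum by blast
  then show ?thesis
    using card by simp
qed

text \<open>With \<open>Y\<close> of size 1 or 3, \<open>sym_diff {b} Y\<close> reaches size 4 only
  if \<open>Y\<close> is a triple avoiding \<open>b\<close>.\<close>

lemma cosupport_beside_singleton:
  assumes "cosupport u {b}" "cosupport v Y" "u \<noteq> v"
  shows "card Y = 3" "b \<notin> Y"
proof -
  have "card (sym_diff {b} Y) + 2 * card ({b} \<inter> Y) = 1 + card Y"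
    using card_sym_diff[of "{b}" Y] by simp
  moreover have "4 \<le> card (sym_diff {b} Y)"
    using cosupport_pair[OF assms] .
  ultimately show "card Y = 3" "b \<notin> Y"
    using cosupport_card[OF assms(2)] by auto
qed

text \<open>As both triples avoid \<open>b\<close>, the bound 5 for three points becomes a bound 4
  for \<open>sym_diff Y Z\<close>. The bound for pairs gives the opposite inequality, so the size 6
  - 2 * \<open>card (Y \<inter> Z)\<close> equals 4.\<close>

lemma cosupport_pair_beside_singleton:
  assumes "cosupport u {b}" "cosupport v Y" "cosupport w Z" "u \<noteq> v" "u \<noteq> w" "v \<noteq> w"
  shows "card (Y \<inter> Z) = 1"
proof -
  note Y = cosupport_beside_singleton[OF assms(1,2,4)]
  note Z = cosupport_beside_singleton[OF assms(1,3,5)]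
  have "sym_diff (sym_diff {b} Y) Z = insert b (sym_diff Y Z)"
    using Y(2) Z(2) by auto
  then have "card (sym_diff (sym_diff {b} Y) Z) = card (sym_diff Y Z) + 1"
    using Y(2) Z(2) by simp
  then have "card (sym_diff Y Z) \<le> 4"
    using cosupport_triple[OF assms] by simp
  moreover have "4 \<le> card (sym_diff Y Z)"
    using cosupport_pair assms by blast
  moreover have "card (sym_diff Y Z) + 2 * card (Y \<inter> Z) = 6"
    using card_sym_diff[of Y Z] Y Z by simp
  ultimately show ?thesis
    by simp
qed

end

section \<open>Normal forms, and frames adapted to zero-sum 8-sets\<close>

lemma two_triples_meeting:
  assumes "card Y = 3" "card Z = 3" "card (Y \<inter> Z) = 1"
  obtains x0 x1 x2 x3 x4 where "Y = {x0, x1, x2}" "Z = {x2, x3, x4}" "distinct [x0, x1, x2, x3, x4]"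
proof -
  obtain x2 where x2: "Y \<inter> Z = {x2}"
    using assms(3) by (auto simp: card_1_singleton_iff)
  have "card (Y - {x2}) = 2" "card (Z - {x2}) = 2"
    using x2 assms by (metis Int_iff card_Diff_singleton diff_Suc_1 insertI1 numeral_3_eq_3 numeral_2_eq_2)+
  then obtain x0 x1 x3 x4 where x: "Y - {x2} = {x0, x1}" "x0 \<noteq> x1" "Z - {x2} = {x3, x4}" "x3 \<noteq> x4"
    by (auto simp: card_2_iff)
  have "Y = {x0, x1, x2}" "Z = {x2, x3, x4}"
    using x x2 by auto
  moreover have "distinct [x0, x1, x2, x3, x4]"
    using x x2 calculation by auto
  ultimately show ?thesis
    using that by blast
qed

text \<open>The indices 0 to 7 label a frame of the 7-dimensional space, and \<open>F\<close> lists
  the index sets whose sums give the points outside it. Equality of \<open>F\<close> therefore means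
  equality up to the choice of frame.\<close>

definition has_normal_form :: "nat set set \<Rightarrow> (bit ^ 7) set \<Rightarrow> bool" where
  "has_normal_form F C \<longleftrightarrow> (\<exists>a. affinely_independent {..<8} a \<and> C = a ` {..<8} \<union> sum a ` F)"

text \<open>Frame points are sums over singletons, so both caps are images of one family of odd
  index sets, and \<open>affine_frames_equivalent\<close> applies.\<close>

lemma has_normal_form_equivalent:
  assumes "has_normal_form F C" "has_normal_form F D"
    and F: "\<And>X. X \<in> F \<Longrightarrow> X \<subseteq> {..<8} \<and> odd (card X)"
  shows "affinely_equivalent C D"
proof -
  obtain a b where a: "affinely_independent {..<8} a" "C = a ` {..<8} \<union> sum a ` F"
    and b: "affinely_independent {..<8} b" "D = b ` {..<8} \<union> sum b ` F"
    using assms unfolding has_normal_form_def by blast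
  let ?F = "(\<lambda>i. {i}) ` {..<8} \<union> F"
  have "affinely_equivalent (sum a ` ?F) (sum b ` ?F)"
    by (rule affine_frames_equivalent[OF a(1) b(1)]) (use F in auto)
  then show ?thesis
    by (simp add: a(2) b(2) image_Un image_image)
qed

lemma has_normal_form_list:
  assumes "affinely_independent B (\<lambda>x. x)" "set xs = B" "distinct xs" "length xs = 8"
    and "C = B \<union> sum ((!) xs) ` F"
  shows "has_normal_form F C"
proof -
  have "affinely_independent {..<8} ((!) xs)"
    unfolding affinely_independent_def
  proof (intro allI impI)
    fix D
    assume D: "D \<subseteq> {..<8}" "even (card D) \<and> sum ((!) xs) D = 0"
    have "inj_on ((!) xs) D"
      using D(1) assms(3,4) by (intro inj_onI) (auto simp: nth_eq_iff_index_eq subset_iff)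
    then have "even (card ((!) xs ` D))" "\<Sum>((!) xs ` D) = 0"
      using D(2) by (simp_all add: card_image sum.reindex)
    moreover have "(!) xs ` D \<subseteq> B"
      using D(1) assms(2,4) by (auto simp: set_conv_nth)
    ultimately show "D = {}"
      using assms(1) unfolding affinely_independent_def by (metis image_is_empty)
  qed
  moreover have "B = (!) xs ` {..<8}"
    using assms(2,4) by (auto simp: set_conv_nth)
  ultimately show ?thesis
    using assms(5) by (auto simp: has_normal_form_def)
qed

lemma (in framed_cap) card_off_frame:
  assumes "card C = n + 8"
  shows "card (C - B) = n"
  using assms card_B B_subset by (simp add: card_Diff_subset)

lemma cap_framed:
  fixes C :: "(bit ^ 7) set"
  assumes "cap C" "10 \<le> card C" "I \<subseteq> C" "affinely_independent I (\<lambda>x. x)"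
  obtains B where "I \<subseteq> B" "affinely_independent B (\<lambda>x. x)" "framed_cap C B"
    and "\<And>c. c \<in> C - B \<Longrightarrow> \<exists>Y. framed_cap.cosupport C B c Y"
proof -
  obtain B where B: "I \<subseteq> B" "B \<subseteq> C" "affinely_independent B (\<lambda>x. x)" "card B = 8"
    and span: "\<And>c. c \<in> C - B \<Longrightarrow> \<exists>X\<subseteq>B. odd (card X) \<and> c = \<Sum>X"
    using cap_frame_exists[OF assms] by blast
  interpret framed_cap C B
    using assms(1) B by unfold_locales
  have "\<exists>Y. cosupport c Y" if "c \<in> C - B" for c
    using cosupport_compl[OF that] span[OF that] by blast
  then show ?thesis
    using that B framed_cap_axioms by blast
qed

text \<open>Seven points of \<open>S\<close> are independent and extend to a frame by a single point
  \<open>b\<close>. The eighth point \<open>p\<close> is the sum of the seven, so its cosupport is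
  \<open>{b}\<close>.\<close>

lemma cap_zero_sum_8_framed:
  fixes C :: "(bit ^ 7) set"
  assumes C: "cap C" "10 \<le> card C" and S: "S \<subseteq> C" "card S = 8" "\<Sum>S = 0"
  obtains B b p where "affinely_independent B (\<lambda>x. x)" "framed_cap C B"
    and "framed_cap.cosupport C B p {b}"
    and "\<And>c. c \<in> C - B \<Longrightarrow> \<exists>Y. framed_cap.cosupport C B c Y"
proof -
  obtain p where p: "p \<in> S"
    using S(2) by fastforce
  \<comment> \<open>A proper nonempty even zero-sum subset and its complement in \<open>S\<close>
    would both have at least six points, but \<open>S\<close> has only eight.\<close>
  have indep: "D = {} \<or> D = S" if D: "D \<subseteq> S" "even (card D)" "\<Sum>D = 0" for D
  proof (rule ccontr)
    assume *: "\<not> (D = {} \<or> D = S)"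
    have card: "card (S - D) = 8 - card D" "card D \<le> 8"
      using D(1) S(2) card_mono[of S D] by (auto simp: card_Diff_subset)
    have "\<Sum>(S - D) = 0"
      using sum.subset_diff[OF D(1), of "\<lambda>x. x"] S(3) D(3) by simp
    moreover have "even (card (S - D))"
      using card D(2) by simp
    ultimately have "6 \<le> card (S - D)"
      using * D(1) S(1) by (intro cap_zero_sum_card_ge_6[OF C(1)]) auto
    moreover have "6 \<le> card D"
      using * D S(1) by (intro cap_zero_sum_card_ge_6[OF C(1)]) auto
    ultimately show False
      using card by simp
  qed
  have "affinely_independent (S - {p}) (\<lambda>x. x)"
    unfolding affinely_independent_def
  proof (intro allI impI)
    fix D
    assume "D \<subseteq> S - {p}" "even (card D) \<and> \<Sum>D = 0"
    with indep[of D] p show "D = {}"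
      by blast
  qed
  moreover have "S - {p} \<subseteq> C"
    using S(1) by blast
  ultimately obtain B where B: "S - {p} \<subseteq> B" "affinely_independent B (\<lambda>x. x)" "framed_cap C B"
    and cosup: "\<And>c. c \<in> C - B \<Longrightarrow> \<exists>Y. framed_cap.cosupport C B c Y"
    using cap_framed[OF C] by metis
  interpret framed_cap C B
    by fact
  have "p \<notin> B"
  proof
    assume "p \<in> B"
    then have "S \<subseteq> B"
      using B(1) by blast
    with B(2) S(2,3) show False
      unfolding affinely_independent_def by (metis card.empty even_numeral zero_neq_numeral)
  qed
  have "card (B - (S - {p})) = 1"
    using card_compl(1)[OF B(1)] S(2) p by simp
  then obtain b where b: "B - (S - {p}) = {b}"
    by (auto simp: card_1_singleton_iff)
  have "odd (card (S - {p}))"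
    using S(2) p by simp
  moreover have "p = \<Sum>(S - {p})"
    using S(3) sum.remove[of S p "\<lambda>x. x"] p by (metis add_0_right bit_vec_add_eq_iff finite_bit_vec_set)
  ultimately have "cosupport p {b}"
    unfolding b[symmetric] using \<open>p \<notin> B\<close> p S(1) B(1) by (intro cosupport_compl) auto
  then show ?thesis
    using that B(2,3) cosup by blast
qed

section \<open>Classification of caps of sizes 10, 11 and 12\<close>

text \<open>Both cosupports are triples, and they meet in one point. Labelled \<open>{0,1,2}\<close>
  and \<open>{2,3,4}\<close>, they have as complements the two sets of the normal form.\<close>

lemma normal_form_10_without_8:
  fixes C :: "(bit ^ 7) set"
  assumes C: "cap C" "card C = 10" and no8: "\<not> (\<exists>S\<subseteq>C. card S = 8 \<and> \<Sum>S = 0)"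
  shows "has_normal_form {{3,4,5,6,7}, {0,1,5,6,7}} C"
proof -
  obtain B where B: "affinely_independent B (\<lambda>x. x)" "framed_cap C B"
    and cosup: "\<And>c. c \<in> C - B \<Longrightarrow> \<exists>Y. framed_cap.cosupport C B c Y"
    using cap_framed[OF C(1) _ empty_subsetI affinely_independent_empty] C(2) by auto
  interpret framed_cap C B
    by fact
  obtain u v where uv: "C - B = {u, v}" "u \<noteq> v"
    using card_off_frame[of 2] C by (auto simp: card_2_iff)
  then obtain Y Z where Y: "cosupport u Y" and Z: "cosupport v Z"
    using cosup by (metis insertI1 insert_commute)
  \<comment> \<open>A singleton cosupport would give a zero-sum set of size 9 - 1 = 8.\<close>
  have card_3: "card X = 3" if "cosupport x X" for x X
    using cosupport_card[OF that] zero_sum_one[OF that] no8 by auto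
  \<comment> \<open>Disjoint triples together with \<open>u\<close> and \<open>v\<close> would be a
    zero-sum 8-set.\<close>
  have "card (sym_diff Y Z) \<noteq> 6"
    using zero_sum_two[OF Y Z uv(2)] no8 by auto
  then have "card (Y \<inter> Z) = 1"
    using cosupport_pair[OF Y Z uv(2)] card_sym_diff[of Y Z] card_3[OF Y] card_3[OF Z]
    by simp
  then obtain x0 x1 x2 x3 x4 where x: "Y = {x0, x1, x2}" "Z = {x2, x3, x4}" "distinct [x0, x1, x2, x3, x4]"
    using two_triples_meeting[of Y Z] card_3[OF Y] card_3[OF Z] by blast
  have sub: "{x0, x1, x2, x3, x4} \<subseteq> B"
    using Y Z by (auto simp: cosupport_def x)
  have "card (B - {x0, x1, x2, x3, x4}) = 3"
    using card_compl(1)[OF sub] x(3) by simp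
  then obtain x5 x6 x7 where x': "B - {x0, x1, x2, x3, x4} = {x5, x6, x7}" "distinct [x5, x6, x7]"
    by (auto simp: card_3_iff)
  let ?xs = "[x0, x1, x2, x3, x4, x5, x6, x7]"
  have set: "set ?xs = B"
    using sub x'(1) by auto
  have dist: "distinct ?xs"
    using x(3) x' by auto
  have sumB: "\<Sum>B = x0 + x1 + x2 + x3 + x4 + x5 + x6 + x7"
    unfolding set[symmetric] using dist by (simp add: ac_simps)
  have "u = \<Sum>B + \<Sum>Y" "v = \<Sum>B + \<Sum>Z"
    using Y Z unfolding cosupport_def by blast+
  then have eq: "u = x3 + x4 + x5 + x6 + x7" "v = x0 + x1 + x5 + x6 + x7"
    using x(3) by (simp_all add: sumB x ac_simps)
  have "C = B \<union> {u, v}"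
    using uv B_subset by blast
  also have "{u, v} = sum ((!) ?xs) ` {{3,4,5,6,7}, {0,1,5,6,7}}"
    by (simp add: eq ac_simps)
  finally have "C = B \<union> sum ((!) ?xs) ` {{3,4,5,6,7}, {0,1,5,6,7}}" .
  then show ?thesis
    by (intro has_normal_form_list[OF B(1) set dist]) auto
qed

text \<open>Triples meeting pairwise in one point either share a common point, with union of size 7,
  or form a triangle, with union of size 6. The bound on the triple symmetric difference leaves only
  the triangle, whose corners are \<open>x0\<close>, \<open>x2\<close>, \<open>x4\<close>.\<close>

lemma three_triples_meeting:
  assumes card: "card Y = 3" "card Z = 3" "card W = 3"
    and meet: "card (Y \<inter> Z) = 1" "card (Y \<inter> W) = 1" "card (Z \<inter> W) = 1"
    and sym_diff: "card (sym_diff (sym_diff Y Z) W) \<le> 5"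
  obtains x0 x1 x2 x3 x4 x5 where "Y = {x0, x1, x2}" "Z = {x2, x3, x4}" "W = {x0, x4, x5}"
    "distinct [x0, x1, x2, x3, x4, x5]"
proof -
  have fin: "finite Y" "finite Z" "finite W"
    using card by (simp_all add: card_ge_0_finite)
  obtain x0 x2 x4 where x: "Y \<inter> W = {x0}" "Y \<inter> Z = {x2}" "Z \<inter> W = {x4}"
    using meet by (metis card_1_singletonE)
  have "card (sym_diff Y Z) = 4" "card (sym_diff Y W) = 4" "card (sym_diff Z W) = 4"
    using card_sym_diff[OF fin(1,2)] card_sym_diff[OF fin(1,3)] card_sym_diff[OF fin(2,3)] card meet
    by linarith+
  \<comment> \<open>The sizes add up to 9 + 12 + t = 4 *
    \<open>card (Y \<union> Z \<union> W)\<close>, where t is at most 5; divisibility by 4 forces t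
    = 3.\<close>
  then have "21 + card (sym_diff (sym_diff Y Z) W) = 4 * card (Y \<union> Z \<union> W)"
    using card_sym_diffs_plotkin[OF fin] card by linarith
  with sym_diff have U: "card (Y \<union> Z \<union> W) = 6"
    by presburger
  \<comment> \<open>\<open>P \<union> Q\<close> has 5 of the 6 points, so \<open>R\<close> meets it
    in two points, and these must be \<open>p\<close> and \<open>q\<close>.\<close>
  have other: "p \<noteq> q"
    if "card P = 3" "card Q = 3" "card R = 3" "card (P \<inter> Q) = 1" "card (P \<union> Q \<union> R) = 6"
      "P \<inter> R = {p}" "Q \<inter> R = {q}" for P Q R p q
  proof -
    have fin: "finite P" "finite Q" "finite R"
      using that(1-3) by (simp_all add: card_ge_0_finite)
    have "card (P \<union> Q) = 5"
      using card_Un_Int[OF fin(1,2)] that(1,2,4) by linarith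
    then have "card ((P \<union> Q) \<inter> R) = 2"
      using card_Un_Int[of "P \<union> Q" R] fin that(3,5) by simp
    moreover have "(P \<union> Q) \<inter> R = {p, q}"
      using that(6,7) by blast
    ultimately show ?thesis
      by auto
  qed
  have x_commute: "W \<inter> Y = {x0}" "Z \<inter> Y = {x2}" "W \<inter> Z = {x4}"
    using x by blast+
  have Un_commute: "Z \<union> W \<union> Y = Y \<union> Z \<union> W" "Y \<union> W \<union> Z = Y \<union> Z \<union> W"
    by blast+
  have ne: "x0 \<noteq> x4" "x2 \<noteq> x0" "x2 \<noteq> x4"
    using other[OF card(1,2,3) meet(1) U x(1,3)]
      other[OF card(2,3,1) meet(3) U[folded Un_commute(1)] x_commute(2,1)]
      other[OF card(1,3,2) meet(2) U[folded Un_commute(2)] x(2) x_commute(3)] .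
  have mem: "x0 \<in> Y" "x2 \<in> Y" "x2 \<in> Z" "x4 \<in> Z" "x4 \<in> W" "x0 \<in> W"
    using x by blast+
  then have "card (Y - {x0, x2}) = 1" "card (Z - {x2, x4}) = 1" "card (W - {x4, x0}) = 1"
    using card ne by (simp_all add: card_Diff_subset)
  then obtain x1 x3 x5 where x': "Y - {x0, x2} = {x1}" "Z - {x2, x4} = {x3}" "W - {x4, x0} = {x5}"
    by (metis card_1_singletonE)
  have "Y = {x0, x2} \<union> (Y - {x0, x2})" "Z = {x2, x4} \<union> (Z - {x2, x4})" "W = {x4, x0} \<union> (W - {x4, x0})"
    using mem by auto
  then have eq: "Y = {x0, x1, x2}" "Z = {x2, x3, x4}" "W = {x0, x4, x5}"
    unfolding x' by auto
  have "x1 \<in> Y - {x0, x2}" "x3 \<in> Z - {x2, x4}" "x5 \<in> W - {x4, x0}"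
    unfolding x' by simp_all
  then have "x1 \<notin> Z" "x1 \<notin> W" "x3 \<notin> Y" "x3 \<notin> W" "x5 \<notin> Y" "x5 \<notin> Z"
    using x by auto
  then have "distinct [x0, x1, x2, x3, x4, x5]"
    using ne unfolding eq by auto
  with eq show ?thesis
    by (rule that)
qed

text \<open>The cosupports are \<open>{7}\<close> and a triple avoiding 7, labelled
  \<open>{0,1,2}\<close>; there is no further choice up to relabelling.\<close>

lemma normal_form_10_with_8:
  fixes C :: "(bit ^ 7) set"
  assumes C: "cap C" "card C = 10" and S: "S \<subseteq> C" "card S = 8" "\<Sum>S = 0"
  shows "has_normal_form {{0,1,2,3,4,5,6}, {3,4,5,6,7}} C"
proof -
  have ge: "10 \<le> card C"
    using C(2) by simp
  obtain B x7 p where B: "affinely_independent B (\<lambda>x. x)" "framed_cap C B"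
    and p: "framed_cap.cosupport C B p {x7}"
    and cosup: "\<And>c. c \<in> C - B \<Longrightarrow> \<exists>Y. framed_cap.cosupport C B c Y"
    using cap_zero_sum_8_framed[OF C(1) ge S] by metis
  interpret framed_cap C B
    by fact
  have "p \<in> C - B"
    using p unfolding cosupport_def by blast
  then have "card (C - B - {p}) = 1"
    using card_off_frame[of 2] C by simp
  then obtain v where "C - B - {p} = {v}"
    by (auto simp: card_1_singleton_iff)
  then have v: "C - B = {p, v}" "p \<noteq> v"
    using \<open>p \<in> C - B\<close> by auto
  then obtain Y where Y: "cosupport v Y"
    using cosup by blast
  note Y' = cosupport_beside_singleton[OF p Y v(2)]
  obtain x0 x1 x2 where x: "Y = {x0, x1, x2}" "distinct [x0, x1, x2]"
    using Y'(1) by (auto simp: card_3_iff)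
  have sub: "{x0, x1, x2, x7} \<subseteq> B"
    using Y p by (auto simp: cosupport_def x)
  have "card (B - {x0, x1, x2, x7}) = 4"
    using card_compl(1)[OF sub] x Y'(2) by auto
  then obtain x3 R where R: "B - {x0, x1, x2, x7} = insert x3 R" "x3 \<notin> R" "card R = 3"
    using card_Suc_eq[of "B - {x0, x1, x2, x7}" 3] by auto
  then obtain x4 x5 x6 where x': "R = {x4, x5, x6}" "distinct [x4, x5, x6]"
    by (auto simp: card_3_iff)
  let ?xs = "[x0, x1, x2, x3, x4, x5, x6, x7]"
  have set: "set ?xs = B"
    using sub R(1) x'(1) by auto
  have dist: "distinct ?xs"
    using x Y'(2) R x' by auto
  have sumB: "\<Sum>B = x0 + x1 + x2 + x3 + x4 + x5 + x6 + x7"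
    unfolding set[symmetric] using dist by (simp add: ac_simps)
  have "p = \<Sum>B + \<Sum>{x7}" "v = \<Sum>B + \<Sum>Y"
    using p Y unfolding cosupport_def by blast+
  then have eq: "p = x0 + x1 + x2 + x3 + x4 + x5 + x6" "v = x3 + x4 + x5 + x6 + x7"
    using x(2) by (simp_all add: sumB x ac_simps)
  have "C = B \<union> {p, v}"
    using v B_subset by blast
  also have "{p, v} = sum ((!) ?xs) ` {{0,1,2,3,4,5,6}, {3,4,5,6,7}}"
    by (simp add: eq ac_simps)
  finally have "C = B \<union> sum ((!) ?xs) ` {{0,1,2,3,4,5,6}, {3,4,5,6,7}}" .
  then show ?thesis
    by (intro has_normal_form_list[OF B(1) set dist]) auto
qed

text \<open>At least three points lie off a frame, so the second part of
  \<open>cap_three_circuits\<close> applies.\<close>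

lemma cap_11_zero_sum_8:
  fixes C :: "(bit ^ 7) set"
  assumes C: "cap C" "11 \<le> card C"
  obtains S where "S \<subseteq> C" "card S = 8" "\<Sum>S = 0"
proof -
  have ge: "10 \<le> card C"
    using C(2) by simp
  obtain B where B: "B \<subseteq> C" "card B = 8"
    and span: "\<And>c. c \<in> C - B \<Longrightarrow> \<exists>X\<subseteq>B. odd (card X) \<and> c = \<Sum>X"
    using cap_frame_exists[OF C(1) ge empty_subsetI affinely_independent_empty] by metis
  have "3 \<le> card (C - B)"
    using B C by (simp add: card_Diff_subset)
  then obtain T where "T \<subseteq> C - B" "card T = 3"
    by (metis obtain_subset_with_card_n)
  then obtain u v w where T: "u \<in> C - B" "v \<in> C - B" "w \<in> C - B" "u \<noteq> v" "u \<noteq> w" "v \<noteq> w"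
    by (auto simp: card_3_iff)
  obtain X Y Z where
    X: "X \<subseteq> B" "odd (card X)" "u = \<Sum>X" and
    Y: "Y \<subseteq> B" "odd (card Y)" "v = \<Sum>Y" and
    Z: "Z \<subseteq> B" "odd (card Z)" "w = \<Sum>Z"
    using T(1-3)[THEN span] by blast
  from cap_three_circuits(2)[OF C(1) B(1) T X Y Z B(2)] show ?thesis
    using that by blast
qed

text \<open>Beside the singleton \<open>{7}\<close> there are two triples that avoid 7 and meet in
  one point, labelled \<open>{0,1,2}\<close> and \<open>{2,3,4}\<close>.\<close>

lemma normal_form_11:
  fixes C :: "(bit ^ 7) set"
  assumes C: "cap C" "card C = 11"
  shows "has_normal_form {{0,1,2,3,4,5,6}, {3,4,5,6,7}, {0,1,5,6,7}} C"
proof -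
  have ge: "11 \<le> card C" "10 \<le> card C"
    using C(2) by simp_all
  obtain S where S: "S \<subseteq> C" "card S = 8" "\<Sum>S = 0"
    using cap_11_zero_sum_8[OF C(1) ge(1)] .
  obtain B x7 p where B: "affinely_independent B (\<lambda>x. x)" "framed_cap C B"
    and p: "framed_cap.cosupport C B p {x7}"
    and cosup: "\<And>c. c \<in> C - B \<Longrightarrow> \<exists>Y. framed_cap.cosupport C B c Y"
    using cap_zero_sum_8_framed[OF C(1) ge(2) S] by metis
  interpret framed_cap C B
    by fact
  have "p \<in> C - B"
    using p unfolding cosupport_def by blast
  then have "card (C - B - {p}) = 2"
    using card_off_frame[of 3] C by simp
  then obtain v w where vw: "C - B - {p} = {v, w}" "v \<noteq> w"
    by (auto simp: card_2_iff)
  then have vw': "C - B = {p, v, w}" "p \<noteq> v" "p \<noteq> w"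
    using \<open>p \<in> C - B\<close> by auto
  then obtain Y Z where Y: "cosupport v Y" and Z: "cosupport w Z"
    using cosup[of v] cosup[of w] by auto
  note Y' = cosupport_beside_singleton[OF p Y vw'(2)]
  note Z' = cosupport_beside_singleton[OF p Z vw'(3)]
  obtain x0 x1 x2 x3 x4 where x: "Y = {x0, x1, x2}" "Z = {x2, x3, x4}" "distinct [x0, x1, x2, x3, x4]"
    using two_triples_meeting[OF Y'(1) Z'(1) cosupport_pair_beside_singleton[OF p Y Z vw'(2,3) vw(2)]] .
  have sub: "{x0, x1, x2, x3, x4, x7} \<subseteq> B"
    using Y Z p by (auto simp: cosupport_def x)
  have "card (B - {x0, x1, x2, x3, x4, x7}) = 2"
    using card_compl(1)[OF sub] x Y'(2) Z'(2) by auto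
  then obtain x5 x6 where x': "B - {x0, x1, x2, x3, x4, x7} = {x5, x6}" "x5 \<noteq> x6"
    by (auto simp: card_2_iff)
  let ?xs = "[x0, x1, x2, x3, x4, x5, x6, x7]"
  have set: "set ?xs = B"
    using sub x'(1) by auto
  have dist: "distinct ?xs"
    using x Y'(2) Z'(2) x' by auto
  have sumB: "\<Sum>B = x0 + x1 + x2 + x3 + x4 + x5 + x6 + x7"
    unfolding set[symmetric] using dist by (simp add: ac_simps)
  have "p = \<Sum>B + \<Sum>{x7}" "v = \<Sum>B + \<Sum>Y" "w = \<Sum>B + \<Sum>Z"
    using p Y Z unfolding cosupport_def by blast+
  then have eq: "p = x0 + x1 + x2 + x3 + x4 + x5 + x6" "v = x3 + x4 + x5 + x6 + x7" "w = x0 + x1 + x5 + x6 + x7"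
    using x(3) by (simp_all add: sumB x ac_simps)
  have "C = B \<union> {p, v, w}"
    using vw' B_subset by blast
  also have "{p, v, w} = sum ((!) ?xs) ` {{0,1,2,3,4,5,6}, {3,4,5,6,7}, {0,1,5,6,7}}"
    by (simp add: eq ac_simps)
  finally have "C = B \<union> sum ((!) ?xs) ` {{0,1,2,3,4,5,6}, {3,4,5,6,7}, {0,1,5,6,7}}" .
  then show ?thesis
    by (intro has_normal_form_list[OF B(1) set dist]) auto
qed

text \<open>Beside the singleton \<open>{7}\<close> the three triples avoid 7 and form a triangle,
  labelled \<open>{0,1,2}\<close>, \<open>{2,3,4}\<close>, \<open>{0,4,5}\<close>. The one remaining
  frame point gets index 6.\<close>

lemma normal_form_12:
  fixes C :: "(bit ^ 7) set"
  assumes C: "cap C" "card C = 12"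
  shows "has_normal_form {{0,1,2,3,4,5,6}, {3,4,5,6,7}, {0,1,5,6,7}, {1,2,3,6,7}} C"
proof -
  have ge: "11 \<le> card C" "10 \<le> card C"
    using C(2) by simp_all
  obtain S where S: "S \<subseteq> C" "card S = 8" "\<Sum>S = 0"
    using cap_11_zero_sum_8[OF C(1) ge(1)] .
  obtain B x7 p where B: "affinely_independent B (\<lambda>x. x)" "framed_cap C B"
    and p: "framed_cap.cosupport C B p {x7}"
    and cosup: "\<And>c. c \<in> C - B \<Longrightarrow> \<exists>Y. framed_cap.cosupport C B c Y"
    using cap_zero_sum_8_framed[OF C(1) ge(2) S] by metis
  interpret framed_cap C B
    by fact
  have "p \<in> C - B"
    using p unfolding cosupport_def by blast
  then have "card (C - B - {p}) = 3"
    using card_off_frame[of 4] C by simp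
  then obtain v w z where vwz: "C - B - {p} = {v, w, z}" "v \<noteq> w" "v \<noteq> z" "w \<noteq> z"
    by (auto simp: card_3_iff)
  then have vwz': "C - B = {p, v, w, z}" "p \<noteq> v" "p \<noteq> w" "p \<noteq> z"
    using \<open>p \<in> C - B\<close> by auto
  then obtain Y Z W where Y: "cosupport v Y" and Z: "cosupport w Z" and W: "cosupport z W"
    using cosup[of v] cosup[of w] cosup[of z] by auto
  note Y' = cosupport_beside_singleton[OF p Y vwz'(2)]
  note Z' = cosupport_beside_singleton[OF p Z vwz'(3)]
  note W' = cosupport_beside_singleton[OF p W vwz'(4)]
  note meet = cosupport_pair_beside_singleton[OF p Y Z vwz'(2,3) vwz(2)]
    cosupport_pair_beside_singleton[OF p Y W vwz'(2,4) vwz(3)]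
    cosupport_pair_beside_singleton[OF p Z W vwz'(3,4) vwz(4)]
  obtain x0 x1 x2 x3 x4 x5 where x: "Y = {x0, x1, x2}" "Z = {x2, x3, x4}" "W = {x0, x4, x5}"
      "distinct [x0, x1, x2, x3, x4, x5]"
    using three_triples_meeting[OF Y'(1) Z'(1) W'(1) meet cosupport_triple[OF Y Z W vwz(2-4)]] .
  have sub: "{x0, x1, x2, x3, x4, x5, x7} \<subseteq> B"
    using Y Z W p by (auto simp: cosupport_def x)
  have "card (B - {x0, x1, x2, x3, x4, x5, x7}) = 1"
    using card_compl(1)[OF sub] x Y'(2) Z'(2) W'(2) by auto
  then obtain x6 where x': "B - {x0, x1, x2, x3, x4, x5, x7} = {x6}"
    by (auto simp: card_1_singleton_iff)
  let ?xs = "[x0, x1, x2, x3, x4, x5, x6, x7]"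
  have set: "set ?xs = B"
    using sub x' by auto
  have dist: "distinct ?xs"
    using x Y'(2) Z'(2) W'(2) x' by auto
  have sumB: "\<Sum>B = x0 + x1 + x2 + x3 + x4 + x5 + x6 + x7"
    unfolding set[symmetric] using dist by (simp add: ac_simps)
  have "p = \<Sum>B + \<Sum>{x7}" "v = \<Sum>B + \<Sum>Y" "w = \<Sum>B + \<Sum>Z" "z = \<Sum>B + \<Sum>W"
    using p Y Z W unfolding cosupport_def by blast+
  then have eq: "p = x0 + x1 + x2 + x3 + x4 + x5 + x6" "v = x3 + x4 + x5 + x6 + x7" "w = x0 + x1 + x5 + x6 + x7"
    "z = x1 + x2 + x3 + x6 + x7"
    using x(4) by (simp_all add: sumB x ac_simps)
  have "C = B \<union> {p, v, w, z}"
    using vwz' B_subset by blast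
  also have "{p, v, w, z} = sum ((!) ?xs) ` {{0,1,2,3,4,5,6}, {3,4,5,6,7}, {0,1,5,6,7}, {1,2,3,6,7}}"
    by (simp add: eq ac_simps)
  finally have "C = B \<union> sum ((!) ?xs) ` {{0,1,2,3,4,5,6}, {3,4,5,6,7}, {0,1,5,6,7}, {1,2,3,6,7}}" .
  then show ?thesis
    by (intro has_normal_form_list[OF B(1) set dist]) auto
qed

section \<open>Existence of a 12-cap\<close>

text \<open>Reading the seven lowest binary digits turns vector addition into \<open>xor\<close>, so
  the example can be checked by evaluating numerals.\<close>

lemma xor_coding_exists:
  obtains e :: "nat \<Rightarrow> bit ^ 7" where "inj_on e {..<128}" "\<And>m n. e m + e n = e (xor m n)" "e 0 = 0"
proof -
  obtain h :: "7 \<Rightarrow> nat" where h: "bij_betw h UNIV {..<7}"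
    using ex_bij_betw_finite_nat[of "UNIV :: 7 set"] by (auto simp: atLeast0LessThan)
  define e :: "nat \<Rightarrow> bit ^ 7" where "e = (\<lambda>n. \<chi> i. of_bool (bit n (h i)))"
  have "e m + e n = e (xor m n)" for m n
    by (auto simp: e_def vec_eq_iff bit_xor_iff)
  moreover have "inj_on e {..<128}"
  proof (rule inj_onI, rule bit_eqI)
    fix m n i :: nat
    assume mn: "m \<in> {..<128}" "n \<in> {..<128}" "e m = e n"
    show "bit m i = bit n i"
    proof (cases "i < 7")
      case True
      then obtain j where "h j = i"
        using h by (metis bij_betw_iff_bijections lessThan_iff)
      moreover have "e m $ j = e n $ j"
        using mn(3) by simp
      ultimately show ?thesis
        by (simp add: e_def of_bool_def split: if_splits)
    next
      case False
      have "take_bit 7 m = m" "take_bit 7 n = n"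
        using mn by (auto simp: take_bit_nat_eq_self)
      with False show ?thesis
        by (metis bit_take_bit_iff)
    qed
  qed
  moreover have "e 0 = 0"
    by (simp add: e_def vec_eq_iff)
  ultimately show ?thesis
    using that by blast
qed

text \<open>Vectors are written as binary numbers. The set \<open>N\<close> below is the normal form of 12-caps over
  the frame \<open>1, 2, 4, 8, 16, 32, 64, 0\<close>.\<close>

lemma cap_12_exists:
  obtains T A :: "(bit ^ 7) set" where "cap T" "card T = 12" "A \<subseteq> T" "card A = 10"
    "\<not> (\<exists>S\<subseteq>A. card S = 8 \<and> \<Sum>S = 0)"
proof -
  obtain e :: "nat \<Rightarrow> bit ^ 7" where e: "inj_on e {..<128}" "\<And>m n. e m + e n = e (xor m n)" "e 0 = 0"
    using xor_coding_exists by blast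
  define N :: "nat set" where "N = {0, 1, 2, 4, 8, 16, 32, 64, 127, 120, 99, 78}"
  \<comment> \<open>Dropping 127 and 78 leaves the frame with the two points of the normal form of
    10-caps without a zero-sum 8-set.\<close>
  define M :: "nat set" where "M = {0, 1, 2, 4, 8, 16, 32, 64, 120, 99}"
  have sub: "N \<subseteq> {..<128}" "M \<subseteq> N"
    by (auto simp: N_def M_def)
  have inj: "inj_on e N" "inj_on e M"
    using e(1) sub by (auto intro: inj_on_subset)
  have e_eq: "m = n" if "e m = e n" "m < 128" "n < 128" for m n
    using e(1) that by (auto dest: inj_onD)
  have xor_less: "xor m n < 128" if "m < 128" "n < 128" for m n :: nat
  proof -
    have "take_bit 7 m = m" "take_bit 7 n = n"
      using that by (simp_all add: take_bit_nat_eq_self)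
    then have "take_bit 7 (xor m n) = xor m n"
      by (simp add: take_bit_xor)
    then show ?thesis
      using take_bit_nat_eq_self_iff[of 7 "xor m n"] by simp
  qed
  \<comment> \<open>In a quad, each point is the sum of the other three.\<close>
  have no_quad: "\<forall>a\<in>N. \<forall>b\<in>N. a \<noteq> b \<longrightarrow> (\<forall>c\<in>N. a \<noteq> c \<longrightarrow> b \<noteq> c \<longrightarrow> xor a (xor b c) \<notin> N)"
    unfolding N_def by simp
  have "cap (e ` N)"
    unfolding cap_def
  proof (rule notI, elim exE conjE)
    fix Q
    assume Q: "Q \<subseteq> e ` N" "quad Q"
    then obtain P where P: "P \<subseteq> N" "Q = e ` P"
      by (auto simp: subset_image_iff)
    have "inj_on e P"
      using inj(1) P(1) inj_on_subset by blast
    then have "card P = 4" "sum e P = 0"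
      using Q(2) P(2) by (auto simp: quad_def card_image sum.reindex)
    then obtain a R where R: "P = insert a R" "a \<notin> R" "card R = 3"
      using card_Suc_eq[of P 3] by auto
    then obtain b c d where bcd: "R = {b, c, d}" "b \<noteq> c" "b \<noteq> d" "c \<noteq> d"
      by (auto simp: card_3_iff)
    have mem: "a \<in> N" "b \<in> N" "c \<in> N" "d \<in> N"
      using P(1) R bcd by auto
    have "e a + (e b + (e c + e d)) = 0"
      using \<open>sum e P = 0\<close> R bcd by simp
    then have "e (xor a (xor b c)) = e d"
      by (simp add: e(2)[symmetric] bit_vec_add_eq_iff ac_simps)
    moreover have "xor a (xor b c) < 128" "d < 128"
      using mem sub by (auto intro!: xor_less)
    ultimately have "xor a (xor b c) = d"
      using e_eq by blast
    moreover have "a \<noteq> b" "a \<noteq> c"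
      using R(2) bcd(1) by auto
    ultimately show False
      using no_quad mem bcd(2) by metis
  qed
  moreover have "card (e ` N) = 12"
    unfolding card_image[OF inj(1)] by (simp add: N_def)
  moreover have "e ` M \<subseteq> e ` N"
    using sub by blast
  moreover have card_M: "card (e ` M) = 10"
    unfolding card_image[OF inj(2)] by (simp add: M_def)
  moreover have "\<not> (\<exists>S\<subseteq>e ` M. card S = 8 \<and> \<Sum>S = 0)"
  proof (rule notI, elim exE conjE)
    fix S
    assume S: "S \<subseteq> e ` M" "card S = 8" "\<Sum>S = 0"
    \<comment> \<open>The two points of \<open>e\<close>
      M\<open>outside\<close>S\<open>would have the same sum as all of\<close>e \<open>M\<close>.
      This total is coded by 100, which is not the \<open>xor\<close> of two members of
      \<open>M\<close>.\<close>
    have "card (e ` M - S) = 2"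
      using S card_M by (simp add: card_Diff_subset)
    then obtain p q where pq: "e ` M - S = {p, q}" "p \<noteq> q"
      by (auto simp: card_2_iff)
    then obtain i j where ij: "i \<in> M" "j \<in> M" "p = e i" "q = e j"
      by blast
    have "\<Sum>(e ` M) = e i + e j"
      using sum.subset_diff[OF S(1), of "\<lambda>x. x"] S(3) pq ij by simp
    also have "\<Sum>(e ` M) = e 100"
      unfolding sum.reindex[OF inj(2)] by (simp add: M_def e)
    finally have "e 100 = e (xor i j)"
      by (simp add: e)
    then have "100 = xor i j"
      by (rule e_eq) (use ij sub in \<open>auto intro!: xor_less\<close>)
    moreover have "\<forall>i\<in>M. \<forall>j\<in>M. xor i j \<noteq> 100"
      unfolding M_def by simp
    ultimately show False
      using ij by metis
  qed
  ultimately show ?thesis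
    by (rule that)
qed

section \<open>Counting the affine classes\<close>

text \<open>The translation is added eight times and cancels, so the sum over the image is the image
  of 0 under the linear part. This is the invariant that separates the two classes of
  10-caps.\<close>

lemma affinely_equivalent_zero_sum_8:
  assumes "affinely_equivalent A B" "S \<subseteq> A" "card S = 8" "\<Sum>S = 0"
  shows "\<exists>S\<subseteq>B. card S = 8 \<and> \<Sum>S = 0"
proof -
  obtain L b where L: "Vector_Spaces.linear (*s) (*s) L"
    and bij: "bij (\<lambda>x. L x + b)" and B: "(\<lambda>x. L x + b) ` A = B"
    using assms(1) unfolding affinely_equivalent_def affine_transformation_def by blast
  let ?f = "\<lambda>x. L x + b"
  have inj: "inj_on ?f S"
    using bij bij_is_inj inj_on_subset by blast
  have "\<Sum>(?f ` S) = (\<Sum>x\<in>S. L x) + (\<Sum>x\<in>S. b)"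
    by (simp add: sum.reindex[OF inj] sum.distrib del: sum_constant)
  also have "\<dots> = 0"
    using vec.linear_sum[OF L, of "\<lambda>x. x" S] assms vec.linear_0[OF L]
    by (simp add: sum_bit_vec_const del: sum_constant)
  finally show ?thesis
    using assms B by (intro exI[of _ "?f ` S"]) (auto simp: card_image[OF inj])
qed

lemma card_affine_classes_representatives:
  assumes "T \<subseteq> X"
    and inequivalent: "\<And>A B. A \<in> T \<Longrightarrow> B \<in> T \<Longrightarrow> affinely_equivalent A B \<Longrightarrow> A = B"
    and cover: "\<And>A. A \<in> X \<Longrightarrow> \<exists>B\<in>T. affinely_equivalent A B"
  shows "card (affine_classes X) = card T"
proof -
  let ?c = "\<lambda>A. affine_equiv_on X `` {A}"
  have eq: "?c A = ?c B \<longleftrightarrow> affinely_equivalent A B" if "A \<in> X" "B \<in> X" for A B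
    using eq_equiv_class_iff[OF equiv_affine_equiv_on that] that by (auto simp: affine_equiv_on_def)
  have "affine_classes X = ?c ` T"
  proof
    show "affine_classes X \<subseteq> ?c ` T"
    proof
      fix K
      assume "K \<in> affine_classes X"
      then obtain A where A: "A \<in> X" "K = ?c A"
        by (auto simp: affine_classes_def quotient_def)
      with cover obtain B where "B \<in> T" "affinely_equivalent A B"
        by blast
      with eq[of A B] A assms(1) show "K \<in> ?c ` T"
        by blast
    qed
    show "?c ` T \<subseteq> affine_classes X"
      using assms(1) by (auto simp: affine_classes_def quotient_def)
  qed
  moreover have "inj_on ?c T"
    using eq inequivalent assms(1) by (intro inj_onI) blast
  ultimately show ?thesis
    by (simp add: card_image)
qed

theorem theorem1p2:
  shows "card (affine_classes (caps_of_size 10 :: (bit ^ 7) set set)) = 2 \<and>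
    card (affine_classes (caps_of_size 11 :: (bit ^ 7) set set)) = 1 \<and>
    card (affine_classes (caps_of_size 12 :: (bit ^ 7) set set)) = 1"
proof -
  \<comment> \<open>All representatives are subsets of one 12-cap \<open>T\<close>: \<open>A\<close>
    has no zero-sum 8-set, \<open>D\<close> is chosen to contain one, and \<open>E\<close> is any
    subset of size 11.\<close>
  obtain T A :: "(bit ^ 7) set" where T: "cap T" "card T = 12"
    and A: "A \<subseteq> T" "card A = 10" "\<not> (\<exists>S\<subseteq>A. card S = 8 \<and> \<Sum>S = 0)"
    using cap_12_exists .
  obtain S where S: "S \<subseteq> T" "card S = 8" "\<Sum>S = 0"
    using cap_11_zero_sum_8[of T] T by auto
  obtain D where D: "S \<subseteq> D" "D \<subseteq> T" "card D = 10"
    using exists_subset_between[of S 10 T] S T by auto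
  obtain E where E: "E \<subseteq> T" "card E = 11"
    using obtain_subset_with_card_n[of 11 T] T by auto
  note caps = cap_subset[OF T(1) A(1)] cap_subset[OF T(1) D(2)] cap_subset[OF T(1) E(1)]
  have not_AD: "\<not> affinely_equivalent A D"
    using affinely_equivalent_zero_sum_8[OF affinely_equivalent_sym D(1) S(2,3)] A(3) by blast
  have "card (affine_classes (caps_of_size 10 :: (bit ^ 7) set set)) = card {A, D}"
  proof (rule card_affine_classes_representatives)
    show "{A, D} \<subseteq> caps_of_size 10"
      using caps A(2) D(3) by (auto simp: caps_of_size_def)
    show "P = Q" if "P \<in> {A, D}" "Q \<in> {A, D}" "affinely_equivalent P Q" for P Q
      using that not_AD affinely_equivalent_sym by blast
    show "\<exists>Q\<in>{A, D}. affinely_equivalent P Q" if "P \<in> caps_of_size 10" for P :: "(bit ^ 7) set"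
    proof -
      have P: "cap P" "card P = 10"
        using that by (auto simp: caps_of_size_def)
      show ?thesis
      \<comment> \<open>In each case \<open>P\<close> and the matching representative have the same
        normal form.\<close>
      proof (cases "\<exists>S\<subseteq>P. card S = 8 \<and> \<Sum>S = 0")
        case True
        then obtain S' where S': "S' \<subseteq> P" "card S' = 8" "\<Sum>S' = 0"
          by blast
        have "affinely_equivalent P D"
          by (rule has_normal_form_equivalent[OF normal_form_10_with_8[OF P S']
                normal_form_10_with_8[OF caps(2) D(3,1) S(2,3)]]) auto
        then show ?thesis
          by blast
      next
        case False
        have "affinely_equivalent P A"
          by (rule has_normal_form_equivalent[OF normal_form_10_without_8[OF P False]
                normal_form_10_without_8[OF caps(1) A(2,3)]]) auto
        then show ?thesis
          by blast
      qed
    qed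
  qed
  moreover have "A \<noteq> D"
    using not_AD affinely_equivalent_refl by blast
  moreover have "card (affine_classes (caps_of_size 11 :: (bit ^ 7) set set)) = card {E}"
  proof (rule card_affine_classes_representatives)
    show "\<exists>Q\<in>{E}. affinely_equivalent P Q" if "P \<in> caps_of_size 11" for P :: "(bit ^ 7) set"
    proof -
      have P: "cap P" "card P = 11"
        using that by (auto simp: caps_of_size_def)
      have "affinely_equivalent P E"
        by (rule has_normal_form_equivalent[OF normal_form_11[OF P] normal_form_11[OF caps(3) E(2)]]) auto
      then show ?thesis
        by simp
    qed
  qed (use caps E in \<open>auto simp: caps_of_size_def\<close>)
  moreover have "card (affine_classes (caps_of_size 12 :: (bit ^ 7) set set)) = card {T}"
  proof (rule card_affine_classes_representatives)
    show "\<exists>Q\<in>{T}. affinely_equivalent P Q" if "P \<in> caps_of_size 12" for P :: "(bit ^ 7) set"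
    proof -
      have P: "cap P" "card P = 12"
        using that by (auto simp: caps_of_size_def)
      have "affinely_equivalent P T"
        by (rule has_normal_form_equivalent[OF normal_form_12[OF P] normal_form_12[OF T]]) auto
      then show ?thesis
        by simp
    qed
  qed (use T in \<open>auto simp: caps_of_size_def\<close>)
  ultimately show ?thesis
    by simp
qed

end
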